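(* Let $n\geq 0$ and $k\geq 1$ be integers, let $\alpha_0,\dots,\alpha_{n-1}$ be real numbers and let $\ell_1,\dots,\ell_k$ be non-zero real numbers. Define $$C_{n,L}^{(k)}(\overline{\alpha})=\int_0^{\ell_1}\cdots\int_0^{\ell_k}\prod_{i=0}^{n-1}\left(x_1x_2\cdots x_k-\alpha_i\right)\,dx_1\cdots dx_k .$$ Then $$C_{n,L}^{(k)}(\overline{\alpha})=\sum_{j=0}^{n}\sum_{m=j}^{n}\frac{S(n,m;\overline{\alpha})\,s(m,j)}{(j+1)^k}\left(\ell_1\ell_2\cdots\ell_k\right)^{j+1}.$$
   Context: $(x)_m=x(x-1)\cdots(x-m+1)$ is the falling factorial and $s(m,j)$ are the (signed) Stirling numbers of the first kind, $(x)_m=\sum_{j=0}^m s(m,j)x^j$. The multiparameter non-central Stirling numbers of the second kind $S(n,m;\overline{\alpha})$ are defined by $\prod_{i=0}^{n-1}(x-\alpha_i)=\sum_{m=0}^{n}S(n,m;\overline{\alpha})\,(x)_m$. *)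

theory Defs
  imports "HOL-Analysis.Analysis" "HOL-Computational_Algebra.Polynomial"
    "HOL-Combinatorics.Stirling"
begin

definition ffact :: "'a::comm_ring_1 \<Rightarrow> nat \<Rightarrow> 'a" where
  "ffact x m = (\<Prod>i<m. x - of_nat i)"

(* The falling factorial of the indeterminate is a polynomial; s(m,j) is its j-th coefficient. *)
definition stirling1 :: "nat \<Rightarrow> nat \<Rightarrow> int" where
  "stirling1 m j = coeff (ffact [:0, 1:] m) j"

(* The vanishing condition beyond n only makes the description definite;
   see ex1_ncstirling2 below for existence and uniqueness. *)
definition ncstirling2 :: "nat \<Rightarrow> nat \<Rightarrow> (nat \<Rightarrow> real) \<Rightarrow> real" where
  "ncstirling2 n m \<alpha> =
     (THE c. (\<forall>x. (\<Prod>i<n. x - \<alpha> i) = (\<Sum>m=0..n. c m * ffact x m)) \<and> (\<forall>m>n. c m = 0)) m"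

(* Iterated oriented integral over the variables x 1, ..., x k, with x i running from 0 to l i;
   x 1 is outermost and x k innermost, and an upper limit may be negative.
   The value 0 in the base case is a dummy for coordinates outside {1..k}. *)
primrec iterated_integral ::
    "nat \<Rightarrow> (nat \<Rightarrow> real) \<Rightarrow> ((nat \<Rightarrow> real) \<Rightarrow> real) \<Rightarrow> real" where
  "iterated_integral 0 l f = f (\<lambda>_. 0)"
| "iterated_integral (Suc k) l f =
     iterated_integral k l (\<lambda>x. LBINT t=ereal 0..ereal (l (Suc k)). f (x(Suc k := t)))"

definition poly_cauchy ::
    "nat \<Rightarrow> nat \<Rightarrow> (nat \<Rightarrow> real) \<Rightarrow> (nat \<Rightarrow> real) \<Rightarrow> real" where
  "poly_cauchy n k l \<alpha> =
     iterated_integral k l (\<lambda>x. \<Prod>i<n. (\<Prod>r=1..k. x r) - \<alpha> i)"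

lemma ffact_0 [simp]: "ffact x 0 = 1"
  by (simp add: ffact_def)

lemma ffact_Suc: "ffact x (Suc m) = ffact x m * (x - of_nat m)"
  by (simp add: ffact_def)

lemma poly_ffact: "poly (ffact p m) x = ffact (poly p x) m"
  by (induction m) (simp_all add: ffact_Suc)

lemma degree_ffact: "degree (ffact [:0, 1::int:] m) = m"
proof (induction m)
  case (Suc m)
  have e: "[:0, 1::int:] - of_nat m = [:- int m, 1:]"
    by (simp add: of_nat_poly)
  have "ffact [:0, 1::int:] m \<noteq> 0"
    unfolding ffact_def by (auto simp: of_nat_poly)
  then show ?case using Suc by (simp add: ffact_Suc e degree_mult_eq del: mult_pCons_right)
qed simp

lemma ffact_eq_sum_stirling1_int: "ffact (x::int) m = (\<Sum>j=0..m. stirling1 m j * x ^ j)"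
proof -
  have "ffact x m = poly (ffact [:0, 1:] m) x" by (simp add: poly_ffact)
  then show ?thesis
    by (simp add: poly_altdef degree_ffact stirling1_def atMost_atLeast0)
qed

lemma stirling1_Suc:
  "stirling1 (Suc m) j = (if j = 0 then 0 else stirling1 m (j - 1)) - int m * stirling1 m j"
proof -
  have e: "[:0, 1::int:] - of_nat m = [:- int m, 1:]"
    by (simp add: of_nat_poly)
  show ?thesis unfolding stirling1_def ffact_Suc e
    by (cases j) (simp_all add: coeff_pCons)
qed

lemma stirling1_above: "j > m \<Longrightarrow> stirling1 m j = 0"
  by (simp add: stirling1_def coeff_eq_0 degree_ffact)

lemma ffact_eq_sum_stirling1:
  "ffact (x::'a::comm_ring_1) m = (\<Sum>j=0..m. of_int (stirling1 m j) * x ^ j)"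
proof (induction m)
  case 0
  show ?case by (simp add: stirling1_def)
next
  case (Suc m)
  have "(\<Sum>j=0..Suc m. of_int (stirling1 (Suc m) j) * x ^ j)
      = (\<Sum>j=0..Suc m. of_int (if j = 0 then 0 else stirling1 m (j - 1)) * x ^ j)
        - of_nat m * (\<Sum>j=0..Suc m. of_int (stirling1 m j) * x ^ j)"
    by (simp add: stirling1_Suc sum_subtractf sum_distrib_left algebra_simps del: sum.atLeast0_atMost_Suc)
  also have "(\<Sum>j=0..Suc m. of_int (if j = 0 then 0 else stirling1 m (j - 1)) * x ^ j)
      = x * (\<Sum>j=0..m. of_int (stirling1 m j) * x ^ j)"
    by (subst sum.atLeast0_atMost_Suc_shift)
       (simp add: sum_distrib_left mult.left_commute)
  also have "(\<Sum>j=0..Suc m. of_int (stirling1 m j) * x ^ j)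
      = (\<Sum>j=0..m. of_int (stirling1 m j) * x ^ j)"
    by (simp add: stirling1_above)
  finally show ?case by (simp add: Suc ffact_Suc algebra_simps)
qed

lemma stirling1_eq_stirling: "stirling1 m j = (-1) ^ (m + j) * int (stirling m j)"
proof (induction m arbitrary: j)
  case 0
  show ?case by (cases j) (simp_all add: stirling1_def)
next
  case (Suc m)
  show ?case
  proof (cases j)
    case 0
    have "int m * int (stirling m 0) = 0" by (cases m) simp_all
    then show ?thesis using 0 by (simp add: stirling1_Suc Suc)
  qed (simp add: stirling1_Suc Suc algebra_simps)
qed

lemma ffact_of_nat_eq_0: "m < p \<Longrightarrow> ffact (real m) p = 0"
  by (auto simp: ffact_def)

lemma ffact_of_nat_nonzero: "ffact (real m) m \<noteq> 0"
  by (auto simp: ffact_def)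

lemma ffact_independent:
  assumes "\<And>x::real. (\<Sum>m=0..n. d m * ffact x m) = 0" and "m \<le> n"
  shows "d m = 0"
  using assms(2)
proof (induction m rule: less_induct)
  case (less m)
  have "(\<Sum>p=0..n. d p * ffact (real m) p) = (\<Sum>p\<in>{m}. d p * ffact (real m) p)"
  proof (rule sum.mono_neutral_right)
    show "\<forall>p\<in>{0..n} - {m}. d p * ffact (real m) p = 0"
    proof
      fix p assume p: "p \<in> {0..n} - {m}"
      show "d p * ffact (real m) p = 0"
        using less.IH[of p] p ffact_of_nat_eq_0[of m p] by (cases "p < m") auto
    qed
  qed (use less in auto)
  then show ?case using assms(1)[of "real m"] ffact_of_nat_nonzero[of m] by simp
qed

lemma ex_ncstirling2:
  "\<exists>c. (\<forall>x::real. (\<Prod>i<n. x - \<alpha> i) = (\<Sum>m=0..n. c m * ffact x m)) \<and> (\<forall>m>n. c m = 0)"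
proof (induction n)
  case 0
  show ?case by (rule exI[of _ "\<lambda>m. if m = 0 then 1 else 0"]) simp
next
  case (Suc n)
  then obtain c where c: "\<And>x::real. (\<Prod>i<n. x - \<alpha> i) = (\<Sum>m=0..n. c m * ffact x m)"
    and c0: "\<And>m. m > n \<Longrightarrow> c m = 0" by blast
  define d where "d m = (if m = 0 then 0 else c (m - 1)) + (real m - \<alpha> n) * c m" for m
  have "(\<Prod>i<Suc n. x - \<alpha> i) = (\<Sum>m=0..Suc n. d m * ffact x m)" for x :: real
  proof -
    have "(\<Sum>m=0..Suc n. d m * ffact x m)
        = (\<Sum>m=0..Suc n. (if m = 0 then 0 else c (m - 1)) * ffact x m)
          + (\<Sum>m=0..Suc n. (real m - \<alpha> n) * c m * ffact x m)"
      by (simp add: d_def distrib_right sum.distrib del: sum.atLeast0_atMost_Suc)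
    also have "(\<Sum>m=0..Suc n. (if m = 0 then 0 else c (m - 1)) * ffact x m)
        = (\<Sum>m=0..n. c m * ffact x (Suc m))"
      by (subst sum.atLeast0_atMost_Suc_shift) simp
    also have "(\<Sum>m=0..Suc n. (real m - \<alpha> n) * c m * ffact x m)
        = (\<Sum>m=0..n. (real m - \<alpha> n) * c m * ffact x m)"
      by (simp add: c0)
    also have "(\<Sum>m=0..n. c m * ffact x (Suc m)) + \<dots> = (\<Sum>m=0..n. c m * ffact x m) * (x - \<alpha> n)"
      unfolding sum_distrib_right sum.distrib [symmetric]
      by (rule sum.cong) (simp_all add: ffact_Suc algebra_simps)
    finally show ?thesis by (simp add: c)
  qed
  moreover have "d m = 0" if "m > Suc n" for m
    using that by (simp add: d_def c0)
  ultimately show ?case by blast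
qed

lemma ex1_ncstirling2:
  "\<exists>!c. (\<forall>x::real. (\<Prod>i<n. x - \<alpha> i) = (\<Sum>m=0..n. c m * ffact x m)) \<and> (\<forall>m>n. c m = 0)"
proof (rule ex_ex1I[OF ex_ncstirling2])
  fix c d :: "nat \<Rightarrow> real"
  assume c: "(\<forall>x::real. (\<Prod>i<n. x - \<alpha> i) = (\<Sum>m=0..n. c m * ffact x m)) \<and> (\<forall>m>n. c m = 0)"
    and d: "(\<forall>x::real. (\<Prod>i<n. x - \<alpha> i) = (\<Sum>m=0..n. d m * ffact x m)) \<and> (\<forall>m>n. d m = 0)"
  have "(\<Sum>m=0..n. (c m - d m) * ffact x m) = 0" for x :: real
    using c d by (simp add: left_diff_distrib sum_subtractf)
  then have "c m - d m = 0" if "m \<le> n" for m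
    using ffact_independent[where n = n and d = "\<lambda>m. c m - d m"] that by simp
  then show "c = d" using c d by (metis eq_iff_diff_eq_0 ext linorder_not_le)
qed

lemma prod_eq_sum_ncstirling2:
  "(\<Prod>i<n. x - \<alpha> i) = (\<Sum>m=0..n. ncstirling2 n m \<alpha> * ffact x m)"
  using theI'[OF ex1_ncstirling2[where n = n and \<alpha> = \<alpha>]] unfolding ncstirling2_def by blast

end

theory Submission imports Defs begin

text \<open>The integrand depends on the variables only through P = x_1 ... x_k and is a polynomial
  in P. Its coefficient at P^j is obtained by expanding in falling factorials and then in powers
  (\<open>prod_eq_sum_ncstirling2_stirling1\<close>). Each variable integrates t^j to l^(j+1)/(j+1),
  so P^j contributes (l_1 ... l_k)^(j+1)/(j+1)^k
  (\<open>iterated_integral_polynomial_prod\<close>).\<close>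

lemma interval_integral_polynomial:
  fixes c :: "nat \<Rightarrow> real"
  shows "(LBINT t=ereal a..ereal b. (\<Sum>j\<le>n. c j * t ^ j)) =
    (\<Sum>j\<le>n. c j * b ^ Suc j / real (Suc j)) - (\<Sum>j\<le>n. c j * a ^ Suc j / real (Suc j))"
\<comment> \<open>The integral is oriented, so one antiderivative serves both orders of
  \<open>a\<close> and \<open>b\<close>.\<close>
proof (rule interval_integral_FTC_finite)
  show "continuous_on {min a b..max a b} (\<lambda>t. \<Sum>j\<le>n. c j * t ^ j)"
    by (intro continuous_intros)
next
  fix t :: real
  have "((\<lambda>t. c j * t ^ Suc j / real (Suc j)) has_real_derivative c j * t ^ j) (at t within A)"
    for j A
    by (rule derivative_eq_intros refl | simp del: of_nat_Suc)+
  then show "((\<lambda>t. \<Sum>j\<le>n. c j * t ^ Suc j / real (Suc j)) has_vector_derivative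
      (\<Sum>j\<le>n. c j * t ^ j)) (at t within {min a b..max a b})"
    unfolding has_real_derivative_iff_has_vector_derivative [symmetric]
    by (rule DERIV_sum)
qed

text \<open>Integrating out the innermost variable leaves a polynomial in the product of the others,
  with c_j multiplied by l^(j+1)/(j+1). The coefficients change at each step, so the induction on
  \<open>k\<close> generalizes over \<open>c\<close>.\<close>

lemma iterated_integral_polynomial_prod:
  fixes c :: "nat \<Rightarrow> real"
  shows "iterated_integral k l (\<lambda>x. \<Sum>j\<le>n. c j * (\<Prod>r=1..k. x r) ^ j) =
    (\<Sum>j\<le>n. c j / (real j + 1) ^ k * (\<Prod>r=1..k. l r) ^ (j + 1))"
proof (induction k arbitrary: c)
  case 0
  show ?case by simp
next
  case (Suc k)
  have inner: "(LBINT t=ereal 0..ereal (l (Suc k)).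
        (\<Sum>j\<le>n. c j * (\<Prod>r=1..Suc k. (x(Suc k := t)) r) ^ j)) =
      (\<Sum>j\<le>n. c j * l (Suc k) ^ (j + 1) / (real j + 1) * (\<Prod>r=1..k. x r) ^ j)" for x
  proof -
    \<comment> \<open>The update touches only the last factor, so t^j separates from a
      constant.\<close>
    have "(\<Prod>r=1..Suc k. (x(Suc k := t)) r) = (\<Prod>r=1..k. x r) * t" for t
      by simp
    then have "(LBINT t=ereal 0..ereal (l (Suc k)).
          (\<Sum>j\<le>n. c j * (\<Prod>r=1..Suc k. (x(Suc k := t)) r) ^ j)) =
        (LBINT t=ereal 0..ereal (l (Suc k)). (\<Sum>j\<le>n. (c j * (\<Prod>r=1..k. x r) ^ j) * t ^ j))"
      by (simp only: power_mult_distrib mult.assoc)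
    then show ?thesis
      unfolding interval_integral_polynomial by (simp add: mult_ac add_ac)
  qed
  show ?case
    unfolding iterated_integral.simps inner Suc.IH
    by (rule sum.cong) (simp_all add: power_mult_distrib mult_ac)
qed

lemma prod_eq_sum_ncstirling2_stirling1:
  "(\<Prod>i<n. x - \<alpha> i) = (\<Sum>j\<le>n. (\<Sum>m=j..n. ncstirling2 n m \<alpha> * of_int (stirling1 m j)) * x ^ j)"
proof -
  have "(\<Prod>i<n. x - \<alpha> i) =
      (\<Sum>m\<le>n. \<Sum>j\<le>m. ncstirling2 n m \<alpha> * of_int (stirling1 m j) * x ^ j)"
    by (simp add: prod_eq_sum_ncstirling2 ffact_eq_sum_stirling1 sum_distrib_left
        atLeast0AtMost mult.assoc)
  also have "\<dots> = (\<Sum>j\<le>n. \<Sum>m=j..n. ncstirling2 n m \<alpha> * of_int (stirling1 m j) * x ^ j)"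
    unfolding sum.Sigma [OF finite_atMost ballI [OF finite_atMost]]
      sum.Sigma [OF finite_atMost ballI [OF finite_atLeastAtMost]]
    \<comment> \<open>Both sides run over the triangle j \<le> m \<le> n, with the coordinates
      exchanged.\<close>
    by (rule sum.reindex_bij_witness[of _ prod.swap prod.swap]) auto
  finally show ?thesis
    by (simp add: sum_distrib_right)
qed

theorem theorem2p2:
  fixes n k :: nat and \<alpha> l :: "nat \<Rightarrow> real"
  assumes "k \<ge> 1"
    and "\<And>r. r \<in> {1..k} \<Longrightarrow> l r \<noteq> 0"
  shows "poly_cauchy n k l \<alpha> =
    (\<Sum>j=0..n. \<Sum>m=j..n.
       ncstirling2 n m \<alpha> * of_int (stirling1 m j) / (real j + 1) ^ k * (\<Prod>r=1..k. l r) ^ (j + 1))"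
  unfolding poly_cauchy_def prod_eq_sum_ncstirling2_stirling1 iterated_integral_polynomial_prod
  by (simp only: sum_divide_distrib sum_distrib_right atLeast0AtMost)

end
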